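(* Let $k\geq 4$ be an integer. Suppose that for every graph $H$ with $\Delta(H)=k-1$ all proper $(\chi'(H)+1)$-edge colorings of $H$ are Kempe equivalent. Then for every Class 2 graph $G$ with $\Delta(G)=k$, all proper $(k+2)$-edge colorings of $G$ are Kempe equivalent.
   Context: All graphs are finite, without loops and multiple edges. $\Delta(G)$ is the maximum degree of $G$. A proper $t$-edge coloring of $G$ is a map $f:E(G)\to\{1,\dots,t\}$ with $f(e)\neq f(e')$ for adjacent edges $e,e'$. The chromatic index $\chi'(G)$ is the least $k$ for which a proper $k$-edge coloring exists; $G$ is Class 2 if $\chi'(G)=\Delta(G)+1$. For a proper edge coloring $f$ and colors $a,b$, $G_f(a,b)$ is the subgraph induced by the edges colored $a$ or $b$. An interchange (Kempe change) consists of swapping colors $a$ and $b$ on one connected component of $G_f(a,b)$. Two proper edge colorings are Kempe equivalent if one can be obtained from the other by a sequence of interchanges. *)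

theory Defs
  imports Main
begin

text \<open>A finite simple graph is represented by its (finite) set of edges, each edge being
a two-element set of vertices. Isolated vertices play no role for edge colourings.\<close>

definition graph :: "'a set set \<Rightarrow> bool" where
  "graph E \<longleftrightarrow> finite E \<and> (\<forall>e\<in>E. card e = 2)"

definition degree :: "'a set set \<Rightarrow> 'a \<Rightarrow> nat" where
  "degree E v = card {e\<in>E. v \<in> e}"

definition max_degree :: "'a set set \<Rightarrow> nat" where
  "max_degree E = Max (insert 0 (degree E ` (\<Union>E)))"

definition proper_edge_coloring :: "'a set set \<Rightarrow> nat \<Rightarrow> ('a set \<Rightarrow> nat) \<Rightarrow> bool" where
  "proper_edge_coloring E t f \<longleftrightarrow>
     (\<forall>e\<in>E. f e \<in> {1..t}) \<and>
     (\<forall>e\<in>E. \<forall>e'\<in>E. e \<noteq> e' \<and> e \<inter> e' \<noteq> {} \<longrightarrow> f e \<noteq> f e')"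

definition chromatic_index :: "'a set set \<Rightarrow> nat" where
  "chromatic_index E = (LEAST t. \<exists>f. proper_edge_coloring E t f)"

definition class2 :: "'a set set \<Rightarrow> bool" where
  "class2 E \<longleftrightarrow> chromatic_index E = max_degree E + 1"

definition two_col_edges :: "'a set set \<Rightarrow> ('a set \<Rightarrow> nat) \<Rightarrow> nat \<Rightarrow> nat \<Rightarrow> 'a set set" where
  "two_col_edges E f a b = {e\<in>E. f e = a \<or> f e = b}"

definition edge_component :: "'a set set \<Rightarrow> 'a set \<Rightarrow> 'a set set" where
  "edge_component F e =
     {e'. (e, e') \<in> ({(x, y). x \<in> F \<and> y \<in> F \<and> x \<inter> y \<noteq> {}})\<^sup>*}"

text \<open>One interchange (Kempe change) among t-edge-colourings: swap colours a and b on
one connected component of G_f(a,b) (components without edges are trivial swaps).\<close>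
definition kempe_step :: "'a set set \<Rightarrow> nat \<Rightarrow> ('a set \<Rightarrow> nat) \<Rightarrow> ('a set \<Rightarrow> nat) \<Rightarrow> bool" where
  "kempe_step E t f g \<longleftrightarrow>
     (\<exists>a\<in>{1..t}. \<exists>b\<in>{1..t}. \<exists>e0\<in>two_col_edges E f a b.
        (\<forall>e\<in>E. g e =
          (if e \<in> edge_component (two_col_edges E f a b) e0
           then (if f e = a then b else a) else f e)))"

definition kempe_equivalent :: "'a set set \<Rightarrow> nat \<Rightarrow> ('a set \<Rightarrow> nat) \<Rightarrow> ('a set \<Rightarrow> nat) \<Rightarrow> bool" where
  "kempe_equivalent E t f g \<longleftrightarrow> (kempe_step E t)\<^sup>*\<^sup>* f g"

definition all_kempe_equivalent :: "'a set set \<Rightarrow> nat \<Rightarrow> bool" where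
  "all_kempe_equivalent E t \<longleftrightarrow>
     (\<forall>f g. proper_edge_coloring E t f \<and> proper_edge_coloring E t g \<longrightarrow> kempe_equivalent E t f g)"

end

theory Submission
  imports Defs
begin

text \<open>Fix a maximal matching \<open>M\<close> of \<open>G\<close>. Vizing's fan argument, carried out with interchanges only,
  brings any \<open>(k + 2)\<close>-colouring down to \<open>k + 1\<close> colours; the colour thus freed can be given to
  the edges of \<open>M\<close> one by one. So it suffices to connect \<open>(k + 1)\<close>-colourings of \<open>G - M\<close>.
  If \<open>M\<close> covers all vertices of degree \<open>k\<close>, then \<open>G - M\<close> has maximum degree \<open>k - 1\<close> and,
  \<open>G\<close> being Class 2, chromatic index \<open>k\<close>, so the hypothesis applies. Otherwise the
  vertices of degree \<open>k\<close> in \<open>G - M\<close> are independent by maximality of \<open>M\<close>, and the fan argument,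
  applied around these vertices, brings the colourings down to \<open>k\<close> colours. Let \<open>N\<close> be a
  colour class of one of the two \<open>k\<close>-colourings obtained. Recolour \<open>N\<close> with colour \<open>k + 1\<close> in
  both; \<open>G - M - N\<close> has maximum degree and chromatic index \<open>k - 1\<close>, and the hypothesis
  applies to it.\<close>

section \<open>Interchanges: properness, reversibility, and passage to larger graphs\<close>

lemma kempe_stepI:
  assumes "a \<in> {1..t}" "b \<in> {1..t}" "e0 \<in> two_col_edges E f a b"
    and "\<And>e. e \<in> E \<Longrightarrow> g e =
          (if e \<in> edge_component (two_col_edges E f a b) e0
           then (if f e = a then b else a) else f e)"
  shows "kempe_step E t f g"
  using assms unfolding kempe_step_def by blast

lemma kempe_stepE:
  assumes "kempe_step E t f g"
  obtains a b e0 where "a \<in> {1..t}" "b \<in> {1..t}" "e0 \<in> two_col_edges E f a b"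
    and "\<And>e. e \<in> E \<Longrightarrow> g e =
          (if e \<in> edge_component (two_col_edges E f a b) e0
           then (if f e = a then b else a) else f e)"
  using assms unfolding kempe_step_def by blast

lemma edge_component_subset:
  assumes "e0 \<in> F" shows "edge_component F e0 \<subseteq> F"
proof
  fix e assume "e \<in> edge_component F e0"
  then have "(e0, e) \<in> {(x, y). x \<in> F \<and> y \<in> F \<and> x \<inter> y \<noteq> {}}\<^sup>*"
    by (simp add: edge_component_def)
  then show "e \<in> F" by (induction) (use assms in auto)
qed

lemma edge_component_self: "e0 \<in> edge_component F e0"
  by (simp add: edge_component_def)

lemma edge_component_closed:
  assumes "e0 \<in> F" "e \<in> edge_component F e0" "e' \<in> F" "e \<inter> e' \<noteq> {}"
  shows "e' \<in> edge_component F e0"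
proof -
  have "e \<in> F" using edge_component_subset assms by blast
  then have "(e, e') \<in> {(x, y). x \<in> F \<and> y \<in> F \<and> x \<inter> y \<noteq> {}}" using assms by simp
  moreover have "(e0, e) \<in> {(x, y). x \<in> F \<and> y \<in> F \<and> x \<inter> y \<noteq> {}}\<^sup>*"
    using assms(2) by (simp add: edge_component_def)
  ultimately show ?thesis
    unfolding edge_component_def by (metis (no_types, lifting) mem_Collect_eq rtrancl_into_rtrancl)
qed

lemma proper_edge_coloringD:
  assumes "proper_edge_coloring E t f" "e \<in> E" "e' \<in> E" "v \<in> e" "v \<in> e'" "f e = f e'"
  shows "e = e'"
  using assms unfolding proper_edge_coloring_def by blast

lemma proper_edge_coloring_range:
  "proper_edge_coloring E t f \<Longrightarrow> e \<in> E \<Longrightarrow> 1 \<le> f e \<and> f e \<le> t"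
  unfolding proper_edge_coloring_def by auto

lemma proper_edge_coloring_mono:
  "proper_edge_coloring E t f \<Longrightarrow> H \<subseteq> E \<Longrightarrow> t \<le> t' \<Longrightarrow> proper_edge_coloring H t' f"
  unfolding proper_edge_coloring_def by (simp add: subset_iff) (meson le_trans)

text \<open>Adjacent edges coloured \<open>a\<close> or \<open>b\<close> lie in one component, so
  they are swapped together or not at all; an edge of a third colour cannot clash with a swapped
  one.\<close>

lemma kempe_step_proper:
  assumes "proper_edge_coloring E t f" "kempe_step E t f g"
  shows "proper_edge_coloring E t g"
proof -
  obtain a b e0 where ab: "a \<in> {1..t}" "b \<in> {1..t}" and e0: "e0 \<in> two_col_edges E f a b"
    and g: "\<And>e. e \<in> E \<Longrightarrow> g e =
          (if e \<in> edge_component (two_col_edges E f a b) e0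
           then (if f e = a then b else a) else f e)"
    using assms(2) by (rule kempe_stepE) (rule that)
  define F where "F = two_col_edges E f a b"
  define C where "C = edge_component F e0"
  have CF: "C \<subseteq> F" using edge_component_subset e0 by (auto simp: C_def F_def)
  have closed: "e' \<in> C" if "e \<in> C" "e' \<in> F" "e \<inter> e' \<noteq> {}" for e e'
    using edge_component_closed[of e0 F e e'] that e0 by (auto simp: C_def F_def)
  have g': "g e = (if e \<in> C then (if f e = a then b else a) else f e)" if "e \<in> E" for e
    using g that by (simp add: C_def F_def)
  have F: "e \<in> F \<longleftrightarrow> e \<in> E \<and> (f e = a \<or> f e = b)" for e
    by (auto simp: F_def two_col_edges_def)
  show ?thesis
    unfolding proper_edge_coloring_def
  proof (intro conjI ballI impI)
    fix e assume "e \<in> E" then show "g e \<in> {1..t}"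
      using g' ab assms(1) by (auto simp: proper_edge_coloring_def)
  next
    fix e e' assume e: "e \<in> E" "e' \<in> E" "e \<noteq> e' \<and> e \<inter> e' \<noteq> {}"
    then have n: "f e \<noteq> f e'" using assms(1) unfolding proper_edge_coloring_def by blast
    have "e' \<in> C" if "e \<in> C" "e' \<in> F" using closed that e by blast
    moreover have "e \<in> C" if "e' \<in> C" "e \<in> F" using closed[of e' e] that e by blast
    ultimately show "g e \<noteq> g e'"
      using n e CF F by (auto simp: g' split: if_splits)
  qed
qed

text \<open>The swap does not change which edges carry \<open>a\<close> or \<open>b\<close>, so the
  same component is still there and swapping it again undoes the step.\<close>

lemma kempe_step_sym:
  assumes "kempe_step E t f g" shows "kempe_step E t g f"
proof -
  obtain a b e0 where ab: "a \<in> {1..t}" "b \<in> {1..t}" and e0: "e0 \<in> two_col_edges E f a b"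
    and g: "\<And>e. e \<in> E \<Longrightarrow> g e =
          (if e \<in> edge_component (two_col_edges E f a b) e0
           then (if f e = a then b else a) else f e)"
    using assms by (rule kempe_stepE) (rule that)
  have CF: "edge_component (two_col_edges E f a b) e0 \<subseteq> two_col_edges E f a b"
    using edge_component_subset e0 by auto
  have eq: "two_col_edges E g a b = two_col_edges E f a b"
    using CF by (auto simp: two_col_edges_def g split: if_splits)
  show ?thesis
  proof (rule kempe_stepI[OF ab, of e0])
    show "e0 \<in> two_col_edges E g a b" using e0 eq by simp
    fix e assume "e \<in> E"
    then show "f e = (if e \<in> edge_component (two_col_edges E g a b) e0
           then (if g e = a then b else a) else g e)"
      unfolding eq using g CF by (auto simp: two_col_edges_def)
  qed
qed

lemma kempe_steps_sym:
  "(kempe_step E t)\<^sup>*\<^sup>* f g \<Longrightarrow> (kempe_step E t)\<^sup>*\<^sup>* g f"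
  by (metis kempe_step_sym sympI symp_rtranclp sympE)

lemma kempe_steps_proper:
  assumes "(kempe_step E t)\<^sup>*\<^sup>* f g" "proper_edge_coloring E t f"
  shows "proper_edge_coloring E t g"
  using assms by induction (auto intro: kempe_step_proper)

text \<open>Interchanging a colour with itself allows arbitrary changes outside \<open>E\<close>.\<close>

lemma kempe_step_cong_edges:
  assumes "proper_edge_coloring E t f" "E \<noteq> {}" "\<And>e. e \<in> E \<Longrightarrow> g e = f e"
  shows "kempe_step E t f g"
proof -
  obtain e0 where e0: "e0 \<in> E" using assms by blast
  have F: "e0 \<in> two_col_edges E f (f e0) (f e0)" using e0 by (simp add: two_col_edges_def)
  show ?thesis
    by (rule kempe_stepI[OF _ _ F])
      (use assms e0 edge_component_subset[OF F] in
        \<open>auto simp: proper_edge_coloring_def two_col_edges_def\<close>)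
qed

text \<open>Colourings are total functions, so later arguments produce functions that agree with the
  intended ones only on \<open>E\<close>. A trivial step at each end repairs this; such a step needs
  some edge, hence \<open>E \<noteq> {}\<close>.\<close>

lemma kempe_steps_cong_edges:
  assumes "(kempe_step E t)\<^sup>*\<^sup>* f g" "proper_edge_coloring E t f" "E \<noteq> {}"
    and "\<And>e. e \<in> E \<Longrightarrow> f' e = f e" "\<And>e. e \<in> E \<Longrightarrow> g' e = g e"
  shows "(kempe_step E t)\<^sup>*\<^sup>* f' g'"
proof -
  have "kempe_step E t f' f" using kempe_step_cong_edges[of E t f f'] assms kempe_step_sym by blast
  moreover have "kempe_step E t g g'"
    using kempe_step_cong_edges[of E t g g'] assms kempe_steps_proper by blast
  ultimately show ?thesis using assms(1)
    by (meson converse_rtranclp_into_rtranclp rtranclp.rtrancl_into_rtrancl)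
qed

text \<open>Edges outside \<open>H\<close> have colours above \<open>t\<close>, so they never enter
  a subgraph of two colours from \<open>{1..t}\<close>, and its components in \<open>E\<close> are
  those in \<open>H\<close>.\<close>

lemma kempe_step_extend:
  assumes "kempe_step H t f g" "H \<subseteq> E" "t \<le> t'" "\<And>e. e \<in> E - H \<Longrightarrow> t < h e"
  shows "kempe_step E t' (\<lambda>e. if e \<in> H then f e else h e) (\<lambda>e. if e \<in> H then g e else h e)"
proof -
  obtain a b e0 where ab: "a \<in> {1..t}" "b \<in> {1..t}" and e0: "e0 \<in> two_col_edges H f a b"
    and g: "\<And>e. e \<in> H \<Longrightarrow> g e =
          (if e \<in> edge_component (two_col_edges H f a b) e0
           then (if f e = a then b else a) else f e)"
    using assms(1) by (rule kempe_stepE) (rule that)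
  have eq: "two_col_edges E (\<lambda>e. if e \<in> H then f e else h e) a b = two_col_edges H f a b"
  proof -
    have "h e \<noteq> a" "h e \<noteq> b" if "e \<in> E - H" for e using assms(4)[OF that] ab by auto
    then show ?thesis using assms(2) by (auto simp: two_col_edges_def)
  qed
  have CH: "edge_component (two_col_edges H f a b) e0 \<subseteq> H"
    using edge_component_subset[OF e0] by (auto simp: two_col_edges_def)
  show ?thesis
    by (rule kempe_stepI[of a _ b e0], unfold eq) (use ab assms(3) e0 g CH in auto)
qed

lemma kempe_steps_extend:
  assumes "(kempe_step H t)\<^sup>*\<^sup>* f g" "H \<subseteq> E" "t \<le> t'" "\<And>e. e \<in> E - H \<Longrightarrow> t < h e"
  shows "(kempe_step E t')\<^sup>*\<^sup>*
    (\<lambda>e. if e \<in> H then f e else h e) (\<lambda>e. if e \<in> H then g e else h e)"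
  using assms(1)
proof induction
  case (step g1 g2)
  then show ?case
    using kempe_step_extend[OF step(2) assms(2-4)] by (meson rtranclp.rtrancl_into_rtrancl)
qed simp

definition misses :: "'a set set \<Rightarrow> ('a set \<Rightarrow> nat) \<Rightarrow> 'a \<Rightarrow> nat \<Rightarrow> bool" where
  "misses E f v c \<longleftrightarrow> (\<forall>e\<in>E. v \<in> e \<longrightarrow> f e \<noteq> c)"

text \<open>A neighbour of \<open>e0\<close> in the two-coloured subgraph would have the colour of
  \<open>e0\<close>, against properness, or \<open>c\<close>, which both ends miss. So
  \<open>e0\<close> alone is a component.\<close>

lemma kempe_step_recolor_edge:
  assumes "proper_edge_coloring E t f" "e0 \<in> E" "c \<in> {1..t}" "\<And>v. v \<in> e0 \<Longrightarrow> misses E f v c"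
  shows "kempe_step E t f (f(e0 := c))"
proof (rule kempe_stepI)
  let ?F = "two_col_edges E f (f e0) c"
  show F: "e0 \<in> ?F" using assms by (simp add: two_col_edges_def)
  have iso: "e = e0" if "e \<in> ?F" "e0 \<inter> e \<noteq> {}" for e
    using that assms(2,4) proper_edge_coloringD[OF assms(1), of e e0]
    by (auto simp: two_col_edges_def misses_def)
  have "edge_component ?F e0 \<subseteq> {e0}"
  proof
    fix e assume "e \<in> edge_component ?F e0"
    then have "(e0, e) \<in> {(x, y). x \<in> ?F \<and> y \<in> ?F \<and> x \<inter> y \<noteq> {}}\<^sup>*"
      by (simp add: edge_component_def)
    then show "e \<in> {e0}" by induction (use iso in auto)
  qed
  then have "edge_component ?F e0 = {e0}" using edge_component_self by blast
  then show "(f(e0 := c)) e = (if e \<in> edge_component ?F e0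
           then (if f e = f e0 then c else f e0) else f e)" for e by simp
qed (use assms in \<open>auto simp: proper_edge_coloring_def\<close>)

definition matching :: "'a set set \<Rightarrow> bool" where
  "matching M \<longleftrightarrow> (\<forall>e\<in>M. \<forall>e'\<in>M. e \<inter> e' \<noteq> {} \<longrightarrow> e = e')"

text \<open>The edges are recoloured one by one. The new colour occurs only on edges of the matching
  already treated, and these do not meet the next one.\<close>

lemma kempe_steps_recolor_matching:
  assumes "proper_edge_coloring E t f" "M \<subseteq> E" "finite M" "matching M"
  shows "(kempe_step E (Suc t))\<^sup>*\<^sup>* f (\<lambda>e. if e \<in> M then Suc t else f e)"
  using assms(3,2,4)
proof (induction M)
  case (insert e M)
  let ?g = "\<lambda>e. if e \<in> M then Suc t else f e"
  have IH: "(kempe_step E (Suc t))\<^sup>*\<^sup>* f ?g"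
    using insert by (simp add: matching_def)
  then have "proper_edge_coloring E (Suc t) ?g"
    using kempe_steps_proper proper_edge_coloring_mono[OF assms(1)] by fastforce
  moreover have "misses E ?g v (Suc t)" if "v \<in> e" for v
    unfolding misses_def
  proof (intro ballI impI)
    fix e' assume "e' \<in> E" "v \<in> e'"
    moreover have "e' \<notin> M" using insert that \<open>v \<in> e'\<close> by (auto simp: matching_def)
    ultimately show "?g e' \<noteq> Suc t" using proper_edge_coloring_range[OF assms(1), of e'] by auto
  qed
  ultimately have "kempe_step E (Suc t) ?g (?g(e := Suc t))"
    using insert by (intro kempe_step_recolor_edge) auto
  moreover have "?g(e := Suc t) = (\<lambda>e'. if e' \<in> insert e M then Suc t else f e')"
    by auto
  ultimately show ?case using IH by (metis (no_types, lifting) rtranclp.rtrancl_into_rtrancl)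
qed auto

subsection \<open>Two-coloured components\<close>

text \<open>Interchanges are defined through components of edges, but the fan argument asks which
  vertices a chain joins; \<open>adj\<close> supplies walks between vertices.\<close>

definition adj :: "'a set set \<Rightarrow> ('a \<times> 'a) set" where
  "adj F = {(u, v). u \<noteq> v \<and> {u, v} \<in> F}"

lemma adj_sym: "(u, v) \<in> adj F \<Longrightarrow> (v, u) \<in> adj F"
  by (auto simp: adj_def insert_commute)

lemma adj_rtrancl_sym: "(u, v) \<in> (adj F)\<^sup>* \<Longrightarrow> (v, u) \<in> (adj F)\<^sup>*"
  by (meson adj_sym symI sym_rtrancl symD)

lemma card_2_adj:
  assumes "card e = 2" "e \<in> F" "u \<in> e" "v \<in> e" shows "(u, v) \<in> (adj F)\<^sup>*"
proof (cases "u = v")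
  case False
  have "e = {u, v}" using assms False by (auto simp: card_2_iff)
  then show ?thesis using False assms by (auto simp: adj_def)
qed simp

lemma edge_component_adj:
  assumes "e \<in> edge_component F e0" "e0 \<in> F" "\<And>e. e \<in> F \<Longrightarrow> card e = 2"
    "u \<in> e0" "v \<in> e"
  shows "(u, v) \<in> (adj F)\<^sup>*"
proof -
  have "(e0, e) \<in> {(x, y). x \<in> F \<and> y \<in> F \<and> x \<inter> y \<noteq> {}}\<^sup>*"
    using assms by (simp add: edge_component_def)
  then show ?thesis using assms(5)
  proof (induction arbitrary: v)
    case base then show ?case using card_2_adj assms by metis
  next
    case (step e1 e2)
    then obtain w where "w \<in> e1" "w \<in> e2" by auto
    with step have "(u, w) \<in> (adj F)\<^sup>*" by blast
    also have "(w, v) \<in> (adj F)\<^sup>*" using card_2_adj step \<open>w \<in> e2\<close> assms(3)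
      by (metis (mono_tags, lifting) case_prodD mem_Collect_eq)
    finally show ?case .
  qed
qed

lemma degree_0_isolated:
  assumes "finite F" "degree F v = 0" "(v, w) \<in> (adj F)\<^sup>*" shows "w = v"
  using assms(3)
proof (induction)
  case (step a b)
  then have "{v, b} \<in> {e\<in>F. v \<in> e}" by (auto simp: adj_def)
  then show ?case using assms(1,2) by (auto simp: degree_def)
qed simp

lemma degree_remove:
  assumes "finite F" "e \<in> F" "v \<in> e" shows "degree (F - {e}) v = degree F v - 1"
proof -
  have "{e' \<in> F - {e}. v \<in> e'} = {e' \<in> F. v \<in> e'} - {e}" by auto
  then show ?thesis using assms by (simp add: degree_def)
qed

lemma degree_mono: "finite F \<Longrightarrow> H \<subseteq> F \<Longrightarrow> degree H v \<le> degree F v"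
  unfolding degree_def by (intro card_mono) auto

text \<open>With all degrees at most 2, components are paths or cycles, and a path has two ends. The
  induction deletes the edge at the end \<open>x\<close>; its other vertex \<open>x'\<close> is then
  an end of what remains and takes the place of \<open>x\<close>.\<close>

lemma at_most_two_endpoints:
  assumes "finite F" "\<And>v. degree F v \<le> 2"
    and "degree F x \<le> 1" "degree F y \<le> 1" "degree F z \<le> 1"
    and "x \<noteq> y" "x \<noteq> z" "y \<noteq> z"
    and "(x, y) \<in> (adj F)\<^sup>*" "(x, z) \<in> (adj F)\<^sup>*"
  shows False
  using assms
proof (induction "card F" arbitrary: F x rule: less_induct)
  case less
  obtain x' where x': "(x, x') \<in> adj F"
    using less.prems by (metis converse_rtranclE)
  define e where "e = {x, x'}"
  define F' where "F' = F - {e}"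
  have e: "e \<in> F" "x \<in> e" "x' \<in> e" "x \<noteq> x'" using x' by (auto simp: e_def adj_def)
  have fin: "finite F'" and lt: "card F' < card F"
    using less.prems(1) e(1) unfolding F'_def by (blast, meson card_Diff1_less)
  have mono: "degree F' v \<le> degree F v" for v
    using less.prems(1) by (auto simp: F'_def intro: degree_mono)
  have dx: "degree F' x = 0" and dx': "degree F' x' \<le> 1"
    using degree_remove[OF less.prems(1) e(1)] e less.prems(2)[of x'] less.prems(3)
    by (auto simp: F'_def)
  have only: "v = x'" if "(x, v) \<in> adj F" for v
  proof (rule ccontr)
    assume "v \<noteq> x'"
    then have "{x, v} \<noteq> e" by (auto simp: e_def doubleton_eq_iff)
    then have "{x, v} \<in> {e \<in> F'. x \<in> e}" using that by (auto simp: F'_def adj_def)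
    then show False using dx fin by (auto simp: degree_def)
  qed
  \<comment> \<open>A walk that visits \<open>x\<close> enters and leaves it through
    \<open>x'\<close>, so the detour can be cut out. At \<open>v = x\<close> the claim is replaced
    by a trivial one to let the induction pass.\<close>
  have walk: "(if v = x then (x', x') else (x', v)) \<in> (adj F')\<^sup>*" if "(x', v) \<in> (adj F)\<^sup>*" for v
    using that
  proof induction
    case (step u v)
    show ?case
    proof (cases "u = x \<or> v = x")
      case True
      then show ?thesis using step only adj_sym by auto
    next
      case False
      then have "(u, v) \<in> adj F'" using step by (auto simp: adj_def F'_def e_def)
      then show ?thesis using step.IH False by (simp add: rtrancl_into_rtrancl)
    qed
  qed simp
  have "(x', y) \<in> (adj F)\<^sup>*" "(x', z) \<in> (adj F)\<^sup>*"
    using x' less.prems adj_sym by (meson converse_rtrancl_into_rtrancl)+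
  then have conn: "(x', y) \<in> (adj F')\<^sup>*" "(x', z) \<in> (adj F')\<^sup>*"
    using walk less.prems by (metis (full_types))+
  \<comment> \<open>If \<open>x'\<close> were \<open>y\<close> or \<open>z\<close>, the deleted edge
    would have been its only one, and it could no longer reach the other of the two.\<close>
  have dead: "degree F' v = 0" if "v = x'" "degree F v \<le> 1" for v
    using degree_remove[OF less.prems(1) e(1), of x'] e that by (auto simp: F'_def)
  have "x' \<noteq> y" using degree_0_isolated[OF fin dead, of y z] conn less.prems by auto
  moreover have "x' \<noteq> z" using degree_0_isolated[OF fin dead, of z y] conn less.prems by auto
  ultimately show False
    using less.hyps[OF lt fin _ dx'] conn less.prems mono by (meson le_trans)
qed

lemma degree_le_card_colors:
  assumes "proper_edge_coloring E t f" "H \<subseteq> E" "finite A" "\<And>e. e \<in> H \<Longrightarrow> v \<in> e \<Longrightarrow> f e \<in> A"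
  shows "degree H v \<le> card A"
proof -
  have "inj_on f {e \<in> H. v \<in> e}"
    using proper_edge_coloringD[OF assms(1)] assms(2) by (auto simp: inj_on_def)
  moreover have "f ` {e \<in> H. v \<in> e} \<subseteq> A" using assms(4) by auto
  ultimately show ?thesis unfolding degree_def using assms(3) by (metis card_inj_on_le)
qed

lemma exists_missing_color:
  assumes "finite E" "degree E v < t"
  shows "\<exists>c\<in>{1..t}. misses E f v c"
proof (rule ccontr)
  assume "\<not> ?thesis"
  then have "{1..t} \<subseteq> f ` {e \<in> E. v \<in> e}" by (auto simp: misses_def)
  then have "card {1..t} \<le> degree E v"
    unfolding degree_def using assms(1) by (intro surj_card_le) auto
  then show False using assms(2) by simp
qed

subsection \<open>Fans\<close>

text \<open>A Vizing fan at \<open>x\<close>. Instead of an uncoloured first edge it has one in the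
  colour \<open>c\<close> that is to be removed or moved; a fan of index \<open>m\<close> has
  \<open>m + 1\<close> edges.\<close>

definition fan :: "'a set set \<Rightarrow> ('a set \<Rightarrow> nat) \<Rightarrow> nat \<Rightarrow> 'a \<Rightarrow> (nat \<Rightarrow> 'a) \<Rightarrow> nat \<Rightarrow> bool" where
  "fan E f c x y m \<longleftrightarrow>
     inj_on y {..m} \<and> (\<forall>i\<le>m. y i \<noteq> x \<and> {x, y i} \<in> E) \<and> f {x, y 0} = c \<and>
     (\<forall>i<m. misses E f (y i) (f {x, y (Suc i)}))"

lemma fan_mono: "fan E f c x y m \<Longrightarrow> n \<le> m \<Longrightarrow> fan E f c x y n"
  unfolding fan_def by (auto intro: inj_on_subset)

text \<open>Rotating the fan from its far end makes every recolouring an interchange on a single edge.\<close>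

lemma rotate_fan:
  assumes "proper_edge_coloring E (Suc t) f" "fan E f (Suc t) x y m"
    and "c \<in> {1..t}" "misses E f x c" "misses E f (y m) c"
  shows "\<exists>g. (kempe_step E (Suc t))\<^sup>*\<^sup>* f g \<and>
    {e\<in>E. g e = Suc t} \<subset> {e\<in>E. f e = Suc t}"
  using assms
proof (induction m arbitrary: f c)
  case 0
  let ?e = "{x, y 0}"
  have "kempe_step E (Suc t) f (f(?e := c))"
    using 0 by (intro kempe_step_recolor_edge) (auto simp: fan_def)
  moreover have "{e\<in>E. (f(?e := c)) e = Suc t} \<subset> {e\<in>E. f e = Suc t}"
    using 0 by (auto simp: fan_def)
  ultimately show ?case by blast
next
  case (Suc m)
  let ?e = "{x, y (Suc m)}"
  let ?g = "f(?e := c)"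
  have inj: "y i = y j \<longleftrightarrow> i = j" if "i \<le> Suc m" "j \<le> Suc m" for i j
    using Suc.prems(2) that by (auto simp: fan_def inj_on_def)
  have fan: "y i \<noteq> x" "{x, y i} \<in> E" if "i \<le> Suc m" for i
    using Suc.prems(2) that by (auto simp: fan_def)
  have miss: "misses E f (y i) (f {x, y (Suc i)})" if "i \<le> m" for i
    using Suc.prems(2) that by (auto simp: fan_def)
  have f0: "f {x, y 0} = Suc t" using Suc.prems(2) by (simp add: fan_def)
  have edge_eq: "{x, y i} = {x, y j} \<longleftrightarrow> i = j" if "i \<le> Suc m" "j \<le> Suc m" for i j
    using that inj fan by (auto simp: doubleton_eq_iff)
  have col: "f ?e = f {x, y i} \<Longrightarrow> i = Suc m" if "i \<le> Suc m" for i
    using proper_edge_coloringD[OF Suc.prems(1), of ?e "{x, y i}" x] fan that edge_eq by auto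
  have step: "kempe_step E (Suc t) f ?g"
    using Suc.prems fan by (intro kempe_step_recolor_edge) auto
  have proper: "proper_edge_coloring E (Suc t) ?g"
    using kempe_step_proper[OF Suc.prems(1) step] .
  have ne: "f ?e \<noteq> Suc t" using col[of 0] f0 by auto
  have c': "f ?e \<in> {1..t}"
    using proper_edge_coloring_range[OF Suc.prems(1), of ?e] fan ne by force
  have keep: "misses E ?g (y i) d" if "i \<le> m" "misses E f (y i) d" for i d
    using that inj[of i "Suc m"] fan[of i] by (auto simp: misses_def)
  have fan': "fan E ?g (Suc t) x y m"
    unfolding fan_def
  proof (intro conjI allI impI)
    show "inj_on y {..m}" using Suc.prems(2) by (auto simp: fan_def intro: inj_on_subset)
    show "?g {x, y 0} = Suc t" using f0 edge_eq[of 0 "Suc m"] by auto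
    fix i assume "i < m"
    then show "misses E ?g (y i) (?g {x, y (Suc i)})"
      using keep[of i] miss[of i] edge_eq[of "Suc i" "Suc m"] by auto
  qed (use fan in auto)
  \<comment> \<open>The colour given up by the last edge is now missing at \<open>x\<close>, and
    \<open>y m\<close> misses it by the fan property; it plays the role of \<open>c\<close> for the
    shorter fan.\<close>
  have "misses E ?g x (f ?e)"
    using proper_edge_coloringD[OF Suc.prems(1), of _ ?e x] fan[of "Suc m"] Suc.prems(4)
    by (auto simp: misses_def)
  moreover have "misses E ?g (y m) (f ?e)" using keep miss by simp
  ultimately obtain g where g: "(kempe_step E (Suc t))\<^sup>*\<^sup>* ?g g"
      "{e\<in>E. g e = Suc t} \<subset> {e\<in>E. ?g e = Suc t}"
    using Suc.IH[OF proper fan' c'] by blast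
  \<comment> \<open>Neither the old nor the new colour of \<open>?e\<close> is \<open>Suc t\<close>:
    the class shrinks only in the base case, when the first fan edge is recoloured.\<close>
  have "{e\<in>E. ?g e = Suc t} = {e\<in>E. f e = Suc t}"
    using Suc.prems(3) ne by auto
  with g(2) have "{e\<in>E. g e = Suc t} \<subset> {e\<in>E. f e = Suc t}" by simp
  then show ?case using converse_rtranclp_into_rtranclp[of "kempe_step E (Suc t)", OF step g(1)]
    by blast
qed

text \<open>The component of an \<open>a\<close>-edge at \<open>v\<close> is swapped. It contains
  all edges at \<open>v\<close> of the two colours, and every vertex on its edges is reachable from
  \<open>v\<close>, so edges at other vertices are untouched.\<close>

lemma kempe_swap_at:
  assumes "graph E" "a \<in> {1..t}" "b \<in> {1..t}" "misses E f v b" "\<not> misses E f v a"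
  shows "\<exists>g. kempe_step E t f g \<and> misses E g v a \<and>
    (\<forall>e\<in>E. (f e \<noteq> a \<and> f e \<noteq> b \<longrightarrow> g e = f e) \<and> (f e = a \<or> f e = b \<longrightarrow> g e = a \<or> g e = b)) \<and>
    (\<forall>w e. (v, w) \<notin> (adj (two_col_edges E f a b))\<^sup>* \<and> e \<in> E \<and> w \<in> e \<longrightarrow> g e = f e)"
proof -
  define F where "F = two_col_edges E f a b"
  obtain e0 where e0: "e0 \<in> E" "v \<in> e0" "f e0 = a" using assms(5) by (auto simp: misses_def)
  define C where "C = edge_component F e0"
  define g where "g = (\<lambda>e. if e \<in> C then (if f e = a then b else a) else f e)"
  have F: "e \<in> F \<longleftrightarrow> e \<in> E \<and> (f e = a \<or> f e = b)" for e
    by (auto simp: F_def two_col_edges_def)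
  have e0F: "e0 \<in> F" using e0 F by simp
  have CF: "C \<subseteq> F" using edge_component_subset[OF e0F] by (simp add: C_def)
  have ne: "a \<noteq> b" using assms(4) e0 by (auto simp: misses_def)
  have "kempe_step E t f g"
    by (rule kempe_stepI[OF assms(2,3), of e0]) (use e0F in \<open>auto simp: g_def C_def F_def\<close>)
  moreover have "misses E g v a"
    unfolding misses_def
  proof (intro ballI impI)
    fix e assume e: "e \<in> E" "v \<in> e"
    have "f e \<noteq> b" using assms(4) e by (auto simp: misses_def)
    moreover have "e \<in> C" if "f e = a"
      unfolding C_def using edge_component_closed[OF e0F edge_component_self] e e0 that F by auto
    ultimately show "g e \<noteq> a" using ne CF F by (auto simp: g_def)
  qed
  moreover have "(f e \<noteq> a \<and> f e \<noteq> b \<longrightarrow> g e = f e) \<and> (f e = a \<or> f e = b \<longrightarrow> g e = a \<or> g e = b)" for e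
    using CF F by (auto simp: g_def)
  moreover have "g e = f e" if "(v, w) \<notin> (adj F)\<^sup>*" "w \<in> e" for w e
  proof -
    have "e \<notin> C"
      using edge_component_adj[of e F e0 v w] that e0F e0(2) F assms(1)
      by (auto simp: C_def graph_def)
    then show ?thesis by (simp add: g_def)
  qed
  ultimately show ?thesis unfolding F_def by blast
qed

text \<open>Vizing's argument for a longest fan. Let its last vertex miss \<open>\<beta>\<close>. If
  \<open>x\<close> misses \<open>\<beta>\<close> too, rotate. Otherwise the
  \<open>\<beta>\<close>-edge at \<open>x\<close> is a fan edge by maximality, and the fan vertex
  before it also misses \<open>\<beta>\<close>. An \<open>\<alpha>\<close>-\<open>\<beta>\<close>
  swap at one of these two vertices makes \<open>\<alpha>\<close> available for a rotation.\<close>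

lemma reduce_top_color_at:
  assumes "graph E" "proper_edge_coloring E (Suc t) f"
    and "y0 \<noteq> x" "{x, y0} \<in> E" "f {x, y0} = Suc t"
    and alpha: "\<alpha> \<in> {1..t}" "misses E f x \<alpha>"
  shows "(\<exists>g. (kempe_step E (Suc t))\<^sup>*\<^sup>* f g \<and> {e\<in>E. g e = Suc t} \<subset> {e\<in>E. f e = Suc t})
    \<or> (\<exists>y m. fan E f (Suc t) x y m \<and> (\<forall>c\<in>{1..t}. \<not> misses E f (y m) c))"
    (is "(\<exists>g. ?good f g) \<or> ?full")
proof -
  have finE: "finite E" and card2: "\<And>e. e \<in> E \<Longrightarrow> card e = 2"
    using assms(1) by (auto simp: graph_def)
  have finV: "finite (\<Union>E)" using finE card2 by (metis card.infinite finite_Union zero_neq_numeral)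
  \<comment> \<open>The length is maximised over all fans at \<open>x\<close>, which exists because
    fan vertices are distinct.\<close>
  define P where "P m \<longleftrightarrow> (\<exists>y. fan E f (Suc t) x y m)" for m
  have "P 0" unfolding P_def fan_def by (rule exI[of _ "\<lambda>_. y0"]) (use assms in auto)
  moreover have "m \<le> card (\<Union>E)" if "P m" for m
  proof -
    obtain y where y: "fan E f (Suc t) x y m" using \<open>P m\<close> by (auto simp: P_def)
    have "y i \<in> \<Union>E" if "i \<le> m" for i
      using y that by (intro UnionI[of "{x, y i}"]) (auto simp: fan_def)
    then have "y ` {..m} \<subseteq> \<Union>E" by auto
    with y have "card {..m} \<le> card (\<Union>E)"
      using card_inj_on_le[of y "{..m}" "\<Union>E"] y finV by (auto simp: fan_def)
    then show ?thesis by simp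
  qed
  ultimately obtain m where m: "P m" and mmax: "\<And>n. P n \<Longrightarrow> n \<le> m"
    using GreatestI_nat[of P 0] Greatest_le_nat[of P] by metis
  obtain y where y: "fan E f (Suc t) x y m" using m by (auto simp: P_def)
  have inj: "y i = y j \<longleftrightarrow> i = j" if "i \<le> m" "j \<le> m" for i j
    using y that by (auto simp: fan_def inj_on_def)
  have nb: "y i \<noteq> x" "{x, y i} \<in> E" if "i \<le> m" for i using y that by (auto simp: fan_def)
  have miss: "misses E f (y i) (f {x, y (Suc i)})" if "i < m" for i
    using y that by (auto simp: fan_def)
  have f0: "f {x, y 0} = Suc t" using y by (simp add: fan_def)
  have col_inj: "i = j" if "i \<le> m" "j \<le> m" "f {x, y i} = f {x, y j}" for i j
    using proper_edge_coloringD[OF assms(2), of "{x, y i}" "{x, y j}" x] nb that inj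
    by (auto simp: doubleton_eq_iff)
  have rot: "\<exists>g. ?good f g" if "n \<le> m" "misses E f (y n) c" "misses E f x c" "c \<in> {1..t}" for n c
    using rotate_fan[OF assms(2) fan_mono[OF y that(1)] that(4,3,2)] .
  show ?thesis
  proof (rule disjCI)
    assume "\<not> ?full"
    then obtain \<beta> where \<beta>: "\<beta> \<in> {1..t}" "misses E f (y m) \<beta>" using y by blast
    show "\<exists>g. ?good f g"
    proof (cases "misses E f x \<beta> \<or> misses E f (y m) \<alpha>")
      case True
      then show ?thesis using rot[of m] \<beta> alpha by blast
    next
      case False
      then obtain e where e: "e \<in> E" "x \<in> e" "f e = \<beta>" by (auto simp: misses_def)
      obtain z where z: "e = {x, z}" "z \<noteq> x" using e card2[OF e(1)] by (auto simp: card_2_iff)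
      \<comment> \<open>Otherwise \<open>z\<close> could be appended to the fan, since
        \<open>y m\<close> misses \<open>\<beta>\<close>.\<close>
      have "z \<in> y ` {..m}"
      proof (rule ccontr)
        assume z': "z \<notin> y ` {..m}"
        let ?y = "y(Suc m := z)"
        have "fan E f (Suc t) x ?y (Suc m)"
          unfolding fan_def
        proof (intro conjI allI impI)
          show "inj_on ?y {..Suc m}"
            using z' y by (auto simp: fan_def inj_on_def le_Suc_eq)
          fix i assume "i < Suc m"
          then show "misses E f (?y i) (f {x, ?y (Suc i)})"
            using miss \<beta> e z by (cases "i = m") auto
        qed (use y e z in \<open>auto simp: fan_def le_Suc_eq\<close>)
        then show False using mmax[of "Suc m"] by (auto simp: P_def)
      qed
      then obtain j where j: "j \<le> m" "z = y j" by auto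
      \<comment> \<open>The first fan edge has colour \<open>Suc t\<close>, above
        \<open>\<beta>\<close>, and the last vertex misses \<open>\<beta>\<close>; so
        \<open>y j\<close> has a predecessor \<open>y i\<close> with \<open>i < m\<close>.\<close>
      have "j \<noteq> 0" using f0 j z e \<beta> by (metis atLeastAtMost_iff not_less_eq_eq order_refl)
      moreover have "j \<noteq> m" using \<beta> j z e by (auto simp: misses_def)
      ultimately obtain i where i: "j = Suc i" "i < m" using j by (metis not0_implies_Suc Suc_leD le_neq_implies_less Suc_le_lessD)
      have f\<beta>: "f {x, y (Suc i)} = \<beta>" using e z j i by simp
      have mi: "misses E f (y i) \<beta>" using miss[OF i(2)] f\<beta> by simp
      show "\<exists>g. ?good f g"
      proof (cases "misses E f (y i) \<alpha>")
        case True
        then show ?thesis using rot[of i] i alpha by auto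
      next
        case nmi: False
        define F where "F = two_col_edges E f \<alpha> \<beta>"
        have F: "e \<in> F \<longleftrightarrow> e \<in> E \<and> (f e = \<alpha> \<or> f e = \<beta>)" for e
          by (auto simp: F_def two_col_edges_def)
        have FE: "F \<subseteq> E" and finF: "finite F" using F finE by (auto intro: finite_subset)
        have ab: "\<alpha> \<noteq> \<beta>" using mi nmi by auto
        have d2: "degree F v \<le> 2" for v
          using degree_le_card_colors[OF assms(2) FE, of "{\<alpha>, \<beta>}" v] F ab by auto
        have d1: "degree F v \<le> 1" if "misses E f v \<alpha> \<or> misses E f v \<beta>" for v
          using degree_le_card_colors[OF assms(2) FE, of "{\<alpha>}" v]
            degree_le_card_colors[OF assms(2) FE, of "{\<beta>}" v] F that by (auto simp: misses_def)
        text \<open>The chain through \<open>x\<close> ends in at most one of the vertices \<open>y i\<close> and \<open>y m\<close>.\<close>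
        have "\<not> ((x, y i) \<in> (adj F)\<^sup>* \<and> (x, y m) \<in> (adj F)\<^sup>*)"
          using at_most_two_endpoints[OF finF d2 d1 d1 d1, of x "y i" "y m"]
            alpha mi \<beta> nb[of i] nb[of m] inj[of i m] i by auto
        \<comment> \<open>If the chain of \<open>x\<close> avoids \<open>y i\<close>, take
          \<open>n = i\<close>. Otherwise it avoids \<open>y m\<close>, whose chain then avoids
          \<open>y i\<close> as well, and \<open>n = m\<close> works.\<close>
        then obtain n where n: "n = i \<or> n = m \<and> (y m, y i) \<notin> (adj F)\<^sup>*" "(y n, x) \<notin> (adj F)\<^sup>*"
          using adj_rtrancl_sym[of _ _ F] rtrancl_trans[of _ _ "adj F"] by metis
        have nm: "n \<le> m" "misses E f (y n) \<beta>" "\<not> misses E f (y n) \<alpha>"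
          using n i mi \<beta> nmi False by auto
        obtain g where g: "kempe_step E (Suc t) f g" "misses E g (y n) \<alpha>"
          and g1: "\<And>e. e \<in> E \<Longrightarrow> f e \<noteq> \<alpha> \<Longrightarrow> f e \<noteq> \<beta> \<Longrightarrow> g e = f e"
          and g2: "\<And>e. e \<in> E \<Longrightarrow> f e = \<alpha> \<or> f e = \<beta> \<Longrightarrow> g e = \<alpha> \<or> g e = \<beta>"
          and g3: "\<And>w e. (y n, w) \<notin> (adj F)\<^sup>* \<Longrightarrow> e \<in> E \<Longrightarrow> w \<in> e \<Longrightarrow> g e = f e"
          using kempe_swap_at[OF assms(1), of \<alpha> "Suc t" \<beta> f "y n"] alpha \<beta> nm
          unfolding F_def by fastforce
        have gx: "g e = f e" if "e \<in> E" "x \<in> e" for e using g3 n that by blast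
        have keep: "misses E g w c" if "misses E f w c" "c \<noteq> \<alpha>" "c \<noteq> \<beta>" for w c
          using that g1 g2 unfolding misses_def by metis
        have "fan E g (Suc t) x y n"
          unfolding fan_def
        proof (intro conjI allI impI)
          show "inj_on y {..n}" using y nm by (auto simp: fan_def intro: inj_on_subset)
          show "g {x, y 0} = Suc t" using gx nb f0 by simp
          fix l assume l: "l < n"
          have gl: "g {x, y (Suc l)} = f {x, y (Suc l)}" using gx nb l nm by simp
          have c: "f {x, y (Suc l)} \<noteq> \<alpha>"
            using alpha(2) nb(2)[of "Suc l"] l nm by (auto simp: misses_def)
          show "misses E g (y l) (g {x, y (Suc l)})"
          \<comment> \<open>Here \<open>n = m\<close>, and \<open>y i\<close> lies off the swapped
            chain, so it still misses \<open>\<beta>\<close>. The other fan edges have colours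
            different from \<open>\<alpha>\<close> and \<open>\<beta>\<close>, which the swap does
            not affect.\<close>
          proof (cases "l = i")
            case True
            then have "(y n, y i) \<notin> (adj F)\<^sup>*" using n l by auto
            then have "misses E g (y i) \<beta>" using mi g3[of "y i"] unfolding misses_def by metis
            then show ?thesis using True gl f\<beta> by simp
          next
            case False
            then have "f {x, y (Suc l)} \<noteq> \<beta>" using col_inj[of "Suc l" "Suc i"] f\<beta> l nm i by auto
            then show ?thesis using keep c miss l nm gl by simp
          qed
        qed (use nb nm in auto)
        moreover have "misses E g x \<alpha>" using alpha(2) gx by (auto simp: misses_def)
        ultimately obtain h where h: "?good g h"
          using rotate_fan[of E t g x y n \<alpha>] kempe_step_proper[OF assms(2) g(1)] alpha(1) g(2)
          by blast
        \<comment> \<open>Both swapped colours are at most \<open>t\<close>.\<close>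
        have "{e\<in>E. g e = Suc t} = {e\<in>E. f e = Suc t}"
        proof -
          have "g e = Suc t \<longleftrightarrow> f e = Suc t" if "e \<in> E" for e
            using g1[OF that] g2[OF that] alpha(1) \<beta>(1) by fastforce
          then show ?thesis by blast
        qed
        with h have "{e\<in>E. h e = Suc t} \<subset> {e\<in>E. f e = Suc t}" by simp
        then show ?thesis
          using h converse_rtranclp_into_rtranclp[of "kempe_step E (Suc t)", OF g(1)] by blast
      qed
    qed
  qed
qed

section \<open>Fans ending at a vertex without missing colour: moving the top colour\<close>

lemma card_Union_matching:
  assumes "finite M" "matching M" "\<And>e. e \<in> M \<Longrightarrow> card e = 2"
  shows "card (\<Union>M) = 2 * card M"
proof -
  have "pairwise disjnt M"
    using assms(2) by (auto simp: matching_def pairwise_def disjnt_def)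
  moreover have "finite e" if "e \<in> M" for e using assms(3)[OF that] by (metis card.infinite zero_neq_numeral)
  ultimately have "card (\<Union>M) = sum card M" by (rule card_Union_disjoint)
  then show ?thesis using assms(3) by simp
qed

text \<open>The swapped chain starts with colour \<open>d\<close> at \<open>v\<close>, so it has at least as many edges of
  colour \<open>d\<close> as of colour \<open>a\<close>.\<close>

lemma kempe_swap_card_le:
  assumes "graph E" "proper_edge_coloring E t f" "a \<in> {1..t}"
    and "e0 \<in> E" "v \<in> e0" "f e0 = d" "misses E f v a"
  shows "\<exists>g. kempe_step E t f g \<and> card {e\<in>E. g e = d} \<le> card {e\<in>E. f e = d} \<and>
    (\<forall>e\<in>E. (f e \<noteq> d \<and> f e \<noteq> a \<longrightarrow> g e = f e) \<and> (f e = d \<or> f e = a \<longrightarrow> g e = d \<or> g e = a)) \<and>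
    (\<forall>e\<in>E. e \<inter> e0 \<noteq> {} \<and> f e = a \<longrightarrow> g e = d)"
proof -
  have finE: "finite E" and card2: "\<And>e. e \<in> E \<Longrightarrow> card e = 2"
    using assms(1) by (auto simp: graph_def)
  define F where "F = two_col_edges E f d a"
  define C where "C = edge_component F e0"
  define g where "g = (\<lambda>e. if e \<in> C then (if f e = d then a else d) else f e)"
  have F: "e \<in> F \<longleftrightarrow> e \<in> E \<and> (f e = d \<or> f e = a)" for e
    by (auto simp: F_def two_col_edges_def)
  have e0F: "e0 \<in> F" using assms F by simp
  have CF: "C \<subseteq> F" using edge_component_subset[OF e0F] by (simp add: C_def)
  have ne: "d \<noteq> a" using assms(4-7) by (auto simp: misses_def)
  have closed: "e' \<in> C" if "e \<in> C" "e' \<in> F" "w \<in> e" "w \<in> e'" for e e' w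
    using edge_component_closed[OF e0F, of e e'] that by (auto simp: C_def)
  have FE: "F \<subseteq> E" and finF: "finite F" using F finE by (auto intro: finite_subset)
  have step: "kempe_step E t f g"
    by (rule kempe_stepI[of d _ a e0])
      (use e0F assms proper_edge_coloring_range[OF assms(2)] in \<open>auto simp: g_def C_def F_def\<close>)
  \<comment> \<open>Both colour classes of the component are matchings, so their sizes can be
    compared by counting the vertices they cover.\<close>
  define A where "A = {e\<in>C. f e = a}"
  define D where "D = {e\<in>C. f e = d}"
  have sub: "A \<subseteq> E" "D \<subseteq> E" using CF FE by (auto simp: A_def D_def)
  then have fin: "finite A" "finite D" using finE finite_subset by auto
  have mat: "matching A" "matching D"
    using proper_edge_coloringD[OF assms(2)] sub unfolding matching_def A_def D_def
    by (auto simp: subset_iff) blast+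
  have cards: "card (\<Union>A) = 2 * card A" "card (\<Union>D) = 2 * card D"
    using card_Union_matching fin mat sub card2 by blast+
  have finU: "finite (\<Union>D)"
    using fin sub card2 by (metis card.infinite finite_Union subsetD zero_neq_numeral)
  have e0D: "e0 \<in> D" using assms(6) edge_component_self by (auto simp: D_def C_def)
  have vA: "v \<notin> \<Union>A" using assms(7) sub by (auto simp: A_def misses_def)
  have d2: "degree F w \<le> 2" for w
    using degree_le_card_colors[OF assms(2) FE, of "{d, a}" w] F ne by auto
  have d1: "degree F w \<le> 1" if "misses E f w d \<or> misses E f w a" for w
    using degree_le_card_colors[OF assms(2) FE, of "{d}" w]
      degree_le_card_colors[OF assms(2) FE, of "{a}" w] F that by (auto simp: misses_def)
  \<comment> \<open>A vertex covered by \<open>A\<close> but not by \<open>D\<close> is an end of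
    the chain, different from the end \<open>v\<close>.\<close>
  have endpt: "misses E f w d" "(v, w) \<in> (adj F)\<^sup>*" "w \<noteq> v" if wAD: "w \<in> \<Union>A - \<Union>D" for w
  proof -
    obtain e where e: "e \<in> C" "f e = a" "w \<in> e" using wAD by (auto simp: A_def)
    show "misses E f w d"
      unfolding misses_def
    proof (intro ballI impI notI)
      fix e' assume "e' \<in> E" "w \<in> e'" "f e' = d"
      then have "e' \<in> D" using closed[of e e' w] e F by (auto simp: D_def)
      then show False using wAD \<open>w \<in> e'\<close> by auto
    qed
    show "(v, w) \<in> (adj F)\<^sup>*"
      using edge_component_adj[of e F e0 v w] e e0F assms(5) card2 FE by (auto simp: C_def)
    show "w \<noteq> v" using wAD vA by auto
  qed
  \<comment> \<open>Together with \<open>v\<close> two such vertices would be three ends of one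
    chain. The single exception is balanced by \<open>v\<close>, which \<open>D\<close> covers and
    \<open>A\<close> does not.\<close>
  have "w = w'" if "w \<in> \<Union>A - \<Union>D" "w' \<in> \<Union>A - \<Union>D" for w w'
    using at_most_two_endpoints[OF finF d2 d1 d1 d1, of v w w'] endpt[OF that(1)] endpt[OF that(2)]
      assms(7) by metis
  then obtain w where "\<Union>A - \<Union>D \<subseteq> {w}" by blast
  then have "\<Union>A \<subseteq> insert w (\<Union>D - {v})" using vA by auto
  then have "card (\<Union>A) \<le> card (insert w (\<Union>D - {v}))" using finU by (intro card_mono) auto
  also have "\<dots> \<le> Suc (card (\<Union>D - {v}))" by (rule card_insert_le_m1) (use finU in auto)
  also have "\<dots> = card (\<Union>D)" using finU e0D assms(5) by (intro card_Suc_Diff1) auto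
  finally have AD: "card A \<le> card D" using cards by simp
  have "{e\<in>E. g e = d} = ({e\<in>E. f e = d} - D) \<union> A"
    using CF F ne by (auto simp: g_def A_def D_def)
  then have "card {e\<in>E. g e = d} \<le> card ({e\<in>E. f e = d} - D) + card A"
    by (simp add: card_Un_le)
  also have "\<dots> \<le> card ({e\<in>E. f e = d} - D) + card D" using AD by simp
  also have "\<dots> = card {e\<in>E. f e = d}"
  proof -
    have "D \<subseteq> {e\<in>E. f e = d}" using sub by (auto simp: D_def)
    then show ?thesis using finE by (simp add: card_Diff_subset card_mono fin)
  qed
  finally have "card {e\<in>E. g e = d} \<le> card {e\<in>E. f e = d}" .
  moreover have "g e = d" if "e \<in> E" "e \<inter> e0 \<noteq> {}" "f e = a" for e
    using closed[of e0 e] that F edge_component_self ne by (auto simp: g_def C_def)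
  moreover have "(f e \<noteq> d \<and> f e \<noteq> a \<longrightarrow> g e = f e) \<and> (f e = d \<or> f e = a \<longrightarrow> g e = d \<or> g e = a)" for e
    using CF F by (auto simp: g_def)
  ultimately show ?thesis using step by blast
qed

text \<open>Unlike a rotation this uses no colour missing at \<open>x\<close>. Let \<open>a\<close>
  be the colour of the second fan edge. Swapping \<open>d\<close> and \<open>a\<close> on the chain
  that starts at \<open>y 0\<close> with the first fan edge gives the second one colour
  \<open>d\<close>, as the two share \<open>x\<close>. Dropping \<open>y 0\<close> leaves a fan
  again.\<close>

lemma shift_fan:
  assumes "graph E" "proper_edge_coloring E t f" "fan E f d x y m"
  shows "\<exists>g. (kempe_step E t)\<^sup>*\<^sup>* f g \<and> card {e\<in>E. g e = d} \<le> card {e\<in>E. f e = d} \<and>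
    g {x, y m} = d"
  using assms(2,3)
proof (induction m arbitrary: f y)
  case 0
  then show ?case by (auto simp: fan_def)
next
  case (Suc m)
  have inj: "y i = y j \<longleftrightarrow> i = j" if "i \<le> Suc m" "j \<le> Suc m" for i j
    using Suc.prems(2) that by (auto simp: fan_def inj_on_def)
  have nb: "y i \<noteq> x" "{x, y i} \<in> E" if "i \<le> Suc m" for i
    using Suc.prems(2) that by (auto simp: fan_def)
  have miss: "misses E f (y i) (f {x, y (Suc i)})" if "i \<le> m" for i
    using Suc.prems(2) that by (auto simp: fan_def)
  have f0: "f {x, y 0} = d" using Suc.prems(2) by (simp add: fan_def)
  have col: "i = j" if "i \<le> Suc m" "j \<le> Suc m" "f {x, y i} = f {x, y j}" for i j
    using proper_edge_coloringD[OF Suc.prems(1), of "{x, y i}" "{x, y j}" x] nb that inj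
    by (auto simp: doubleton_eq_iff)
  define a where "a = f {x, y 1}"
  have "a \<in> {1..t}"
    using proper_edge_coloring_range[OF Suc.prems(1), of "{x, y 1}"] nb[of 1] by (simp add: a_def)
  then obtain g where g: "kempe_step E t f g" "card {e\<in>E. g e = d} \<le> card {e\<in>E. f e = d}"
    and g1: "\<And>e. e \<in> E \<Longrightarrow> f e \<noteq> d \<Longrightarrow> f e \<noteq> a \<Longrightarrow> g e = f e"
    and g2: "\<And>e. e \<in> E \<Longrightarrow> f e = d \<or> f e = a \<Longrightarrow> g e = d \<or> g e = a"
    and g3: "\<And>e. e \<in> E \<Longrightarrow> e \<inter> {x, y 0} \<noteq> {} \<Longrightarrow> f e = a \<Longrightarrow> g e = d"
    using kempe_swap_card_le[OF assms(1) Suc.prems(1), of a "{x, y 0}" "y 0" d]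
      f0 nb[of 0] miss[of 0] by (auto simp: a_def)
  let ?y = "\<lambda>i. y (Suc i)"
  have keep: "misses E g w c" if "misses E f w c" "c \<noteq> d" "c \<noteq> a" for w c
    using that g1 g2 unfolding misses_def by metis
  have "fan E g d x ?y m"
    unfolding fan_def
  proof (intro conjI allI impI)
    show "inj_on ?y {..m}" using inj by (auto simp: inj_on_def)
    show "g {x, y (Suc 0)} = d" using g3[of "{x, y 1}"] nb[of 1] by (simp add: a_def)
    fix l assume l: "l < m"
    \<comment> \<open>Colours at \<open>x\<close> are distinct, so the later fan edges avoid both
      swapped colours and the fan property survives.\<close>
    have "f {x, y (Suc (Suc l))} \<noteq> d" "f {x, y (Suc (Suc l))} \<noteq> a"
      using col[of "Suc (Suc l)" 0] col[of "Suc (Suc l)" 1] l f0 by (auto simp: a_def)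
    then show "misses E g (y (Suc l)) (g {x, y (Suc (Suc l))})"
      using g1[of "{x, y (Suc (Suc l))}"] nb[of "Suc (Suc l)"] keep miss[of "Suc l"] l by simp
  qed (use nb in auto)
  from Suc.IH[OF kempe_step_proper[OF Suc.prems(1) g(1)] this]
  obtain h where h: "(kempe_step E t)\<^sup>*\<^sup>* g h" "card {e\<in>E. h e = d} \<le> card {e\<in>E. g e = d}"
    "h {x, y (Suc m)} = d" by blast
  then show ?case
    using converse_rtranclp_into_rtranclp[of "kempe_step E t", OF g(1) h(1)] g(2)
    by (blast intro: le_trans)
qed

text \<open>With \<open>t\<close> larger than the maximum degree this is Vizing's theorem; with \<open>t\<close> equal to it,
  Fournier's theorem for an independent set of vertices of maximum degree.\<close>

lemma kempe_reduce_colors: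
  assumes "graph E" and deg: "\<And>v. degree E v \<le> t"
    and indep: "\<And>u v. u \<noteq> v \<Longrightarrow> {u, v} \<in> E \<Longrightarrow> degree E u < t \<or> degree E v < t"
    and "proper_edge_coloring E (Suc t) f"
  shows "\<exists>g. (kempe_step E (Suc t))\<^sup>*\<^sup>* f g \<and> proper_edge_coloring E t g"
  using assms(4)
proof (induction "card {e\<in>E. f e = Suc t}" arbitrary: f rule: less_induct)
  case less
  have finE: "finite E" and card2: "\<And>e. e \<in> E \<Longrightarrow> card e = 2"
    using assms(1) by (auto simp: graph_def)
  have card_less: "card {e\<in>E. h e = Suc t} < card {e\<in>E. g e = Suc t}"
    if "{e\<in>E. h e = Suc t} \<subset> {e\<in>E. g e = Suc t}" for g h :: "'a set \<Rightarrow> nat"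
    using that finE by (intro psubset_card_mono) auto
  \<comment> \<open>One of the at most \<open>t\<close> edges at \<open>x\<close> has colour
    \<open>Suc t\<close>, so the others cannot use all of \<open>{1..t}\<close>.\<close>
  have free: "\<exists>c\<in>{1..t}. misses E g x c" if "e \<in> E" "x \<in> e" "g e = Suc t" for e x g
  proof -
    have "degree E x \<noteq> 0" using finE that by (auto simp: degree_def)
    then have "degree (E - {e}) x < t" using degree_remove[OF finE that(1,2)] deg[of x] by linarith
    then obtain c where c: "c \<in> {1..t}" "misses (E - {e}) g x c"
      using exists_missing_color[of "E - {e}" x t g] finE by auto
    moreover have "g e \<noteq> c" using c that(3) by auto
    ultimately show ?thesis unfolding misses_def by blast
  qed
  have full: "degree E v = t" if "\<forall>c\<in>{1..t}. \<not> misses E g v c" for g v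
    using exists_missing_color[OF finE, of v t g] that deg[of v] by (meson le_neq_implies_less)
  have goal: ?case
    if "(kempe_step E (Suc t))\<^sup>*\<^sup>* f g" "card {e\<in>E. g e = Suc t} < card {e\<in>E. f e = Suc t}" for g
    using less.hyps[OF that(2) kempe_steps_proper[OF that(1) less.prems]] that(1)
    by (meson rtranclp_trans)
  show ?case
  proof (cases "{e\<in>E. f e = Suc t} = {}")
    case True
    then have "proper_edge_coloring E t f"
      using less.prems by (fastforce simp: proper_edge_coloring_def le_Suc_eq)
    then show ?thesis by blast
  next
    case False
    then obtain e0 where e0: "e0 \<in> E" "f e0 = Suc t" by blast
    then obtain x y0 where x: "e0 = {x, y0}" "y0 \<noteq> x" using card2 by (metis card_2_iff)
    obtain \<alpha> where \<alpha>: "\<alpha> \<in> {1..t}" "misses E f x \<alpha>" using free[of e0 x f] e0 x by auto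
    from reduce_top_color_at[OF assms(1) less.prems x(2) _ _ \<alpha>] e0 x
    consider g where "(kempe_step E (Suc t))\<^sup>*\<^sup>* f g" "{e\<in>E. g e = Suc t} \<subset> {e\<in>E. f e = Suc t}"
      | y m where "fan E f (Suc t) x y m" "\<forall>c\<in>{1..t}. \<not> misses E f (y m) c"
      by blast
    then show ?thesis
    proof cases
      case 1
      then show ?thesis using goal card_less by blast
    next
      case 2
      \<comment> \<open>The obstructing fan ends at a vertex of degree \<open>t\<close>. The top
        colour is moved to the edge from \<open>z\<close> to \<open>x\<close>, and fans are then
        taken at \<open>z\<close> instead of \<open>x\<close>.\<close>
      define z where "z = y m"
      have z: "z \<noteq> x" "{z, x} \<in> E" "degree E z = t"
        using 2 full by (auto simp: z_def fan_def insert_commute)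
      obtain g where g: "(kempe_step E (Suc t))\<^sup>*\<^sup>* f g"
        "card {e\<in>E. g e = Suc t} \<le> card {e\<in>E. f e = Suc t}" "g {z, x} = Suc t"
        using shift_fan[OF assms(1) less.prems 2(1)] by (auto simp: z_def insert_commute)
      obtain \<gamma> where \<gamma>: "\<gamma> \<in> {1..t}" "misses E g z \<gamma>" using free[of "{z, x}" z g] z g by auto
      \<comment> \<open>An obstruction here would end at a neighbour of \<open>z\<close> of degree
        \<open>t\<close>, against \<open>indep\<close>.\<close>
      have "\<not> (fan E g (Suc t) z y' n \<and> (\<forall>c\<in>{1..t}. \<not> misses E g (y' n) c))" for y' n
        using full[of g "y' n"] indep[of z "y' n"] z by (auto simp: fan_def)
      then obtain h where h: "(kempe_step E (Suc t))\<^sup>*\<^sup>* g h"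
        "{e\<in>E. h e = Suc t} \<subset> {e\<in>E. g e = Suc t}"
        using reduce_top_color_at[OF assms(1) kempe_steps_proper[OF g(1) less.prems]
            z(1)[symmetric] z(2) g(3) \<gamma>] by blast
      show ?thesis
        by (rule goal[of h]) (use g h card_less[OF h(2)] in \<open>auto intro: rtranclp_trans\<close>)
    qed
  qed
qed

lemma proper_edge_coloring_cong:
  "proper_edge_coloring E t f \<Longrightarrow> (\<And>e. e \<in> E \<Longrightarrow> g e = f e) \<Longrightarrow> proper_edge_coloring E t g"
  by (simp add: proper_edge_coloring_def)

subsection \<open>Transport along an injection of the vertices\<close>

context
  fixes E :: "'a set set" and p :: "'a \<Rightarrow> 'b"
  assumes inj: "inj_on p (\<Union>E)"
begin

lemma inj_on_edge_image: "inj_on ((`) p) E"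
  using inj_on_image[OF inj] .

lemma edge_image_disjoint_iff:
  assumes "e \<in> E" "e' \<in> E" shows "p ` e \<inter> p ` e' = {} \<longleftrightarrow> e \<inter> e' = {}"
  using inj_on_image_Int[OF inj, of e e'] assms by (metis Sup_upper image_is_empty)

lemma graph_edge_image: "graph E \<Longrightarrow> graph ((`) p ` E)"
  unfolding graph_def using inj by (auto simp: card_image inj_on_subset Sup_upper)

lemma degree_edge_image:
  assumes "v \<in> \<Union>E" shows "degree ((`) p ` E) (p v) = degree E v"
proof -
  have "p v \<in> p ` e \<longleftrightarrow> v \<in> e" if "e \<in> E" for e
    using inj_on_image_mem_iff[OF inj assms] that by blast
  then have "{x \<in> (`) p ` E. p v \<in> x} = (`) p ` {e \<in> E. v \<in> e}" by blast
  then show ?thesis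
    unfolding degree_def using inj_on_edge_image by (simp add: card_image inj_on_subset)
qed

lemma max_degree_edge_image: "max_degree ((`) p ` E) = max_degree E"
proof -
  have "\<Union>((`) p ` E) = p ` \<Union>E" by blast
  then have "degree ((`) p ` E) ` \<Union>((`) p ` E) = degree E ` \<Union>E"
    using degree_edge_image by (simp add: image_image)
  then show ?thesis by (simp add: max_degree_def)
qed

lemma proper_edge_coloring_edge_image:
  "proper_edge_coloring ((`) p ` E) t f \<longleftrightarrow> proper_edge_coloring E t (\<lambda>e. f (p ` e))"
proof -
  have "p ` e = p ` e' \<longleftrightarrow> e = e'" if "e \<in> E" "e' \<in> E" for e e'
    using inj_on_edge_image that by (auto simp: inj_on_def)
  then show ?thesis
    unfolding proper_edge_coloring_def by (simp add: edge_image_disjoint_iff)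
qed

lemma proper_edge_coloring_pullback:
  assumes "proper_edge_coloring E t f"
  shows "proper_edge_coloring ((`) p ` E) t (\<lambda>x. f (inv_into E ((`) p) x))"
  unfolding proper_edge_coloring_edge_image
  using assms inv_into_f_f[OF inj_on_edge_image] by (simp add: proper_edge_coloring_def)

lemma chromatic_index_edge_image: "chromatic_index ((`) p ` E) = chromatic_index E"
proof -
  have "(\<exists>f. proper_edge_coloring ((`) p ` E) t f) \<longleftrightarrow> (\<exists>f. proper_edge_coloring E t f)" for t
    using proper_edge_coloring_pullback proper_edge_coloring_edge_image by blast
  then show ?thesis by (simp add: chromatic_index_def)
qed

text \<open>Walks of edges map forward directly. Backward, each edge on the walk is lifted to a
  preimage in \<open>F\<close>; injectivity ensures that lifted consecutive edges still
  meet.\<close>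

lemma edge_component_edge_image:
  assumes "F \<subseteq> E" "e0 \<in> F" "e \<in> E"
  shows "p ` e \<in> edge_component ((`) p ` F) (p ` e0) \<longleftrightarrow> e \<in> edge_component F e0"
proof
  assume "e \<in> edge_component F e0"
  then have "(e0, e) \<in> {(x, y). x \<in> F \<and> y \<in> F \<and> x \<inter> y \<noteq> {}}\<^sup>*"
    by (simp add: edge_component_def)
  then show "p ` e \<in> edge_component ((`) p ` F) (p ` e0)"
  proof induction
    case (step e1 e2)
    then show ?case
      using edge_component_closed[of "p ` e0" "(`) p ` F" "p ` e1" "p ` e2"] assms(2) by blast
  qed (rule edge_component_self)
next
  assume "p ` e \<in> edge_component ((`) p ` F) (p ` e0)"
  then have "(p ` e0, p ` e) \<in> {(x, y). x \<in> (`) p ` F \<and> y \<in> (`) p ` F \<and> x \<inter> y \<noteq> {}}\<^sup>*"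
    by (simp add: edge_component_def)
  then have "\<exists>e'\<in>F. p ` e = p ` e' \<and> e' \<in> edge_component F e0"
  proof induction
    case base
    then show ?case using assms(2) edge_component_self by blast
  next
    case (step x1 x2)
    then obtain e1 e2 where e: "e1 \<in> F" "x1 = p ` e1" "e1 \<in> edge_component F e0"
      "e2 \<in> F" "x2 = p ` e2" by auto
    then have "e1 \<inter> e2 \<noteq> {}"
      using step(2) edge_image_disjoint_iff[of e1 e2] assms(1) by auto
    then have "e2 \<in> edge_component F e0" using edge_component_closed[OF assms(2) e(3,4)] by blast
    then show ?case using e by blast
  qed
  then show "e \<in> edge_component F e0"
    using inj_on_edge_image assms(1,3) by (metis inj_onD subsetD)
qed

lemma kempe_step_edge_image:
  assumes "kempe_step ((`) p ` E) t f g"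
  shows "kempe_step E t (\<lambda>e. f (p ` e)) (\<lambda>e. g (p ` e))"
proof -
  let ?H = "(`) p ` E"
  obtain a b x0 where ab: "a \<in> {1..t}" "b \<in> {1..t}" and x0: "x0 \<in> two_col_edges ?H f a b"
    and g: "\<And>x. x \<in> ?H \<Longrightarrow> g x =
          (if x \<in> edge_component (two_col_edges ?H f a b) x0
           then (if f x = a then b else a) else f x)"
    using assms by (rule kempe_stepE) (rule that)
  define F where "F = two_col_edges E (\<lambda>e. f (p ` e)) a b"
  have F: "two_col_edges ?H f a b = (`) p ` F" "F \<subseteq> E"
    by (auto simp: two_col_edges_def F_def)
  then obtain e0 where e0: "e0 \<in> F" "x0 = p ` e0" using x0 by auto
  have "g (p ` e) = (if e \<in> edge_component F e0 then (if f (p ` e) = a then b else a) else f (p ` e))"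
    if "e \<in> E" for e
    using g[of "p ` e"] that edge_component_edge_image[OF F(2) e0(1) that] unfolding F(1) e0(2) by simp
  then show ?thesis
    using kempe_stepI[OF ab, of e0 E "\<lambda>e. f (p ` e)" "\<lambda>e. g (p ` e)"] e0(1) by (simp add: F_def)
qed

lemma kempe_steps_edge_image:
  assumes "(kempe_step ((`) p ` E) t)\<^sup>*\<^sup>* f g"
  shows "(kempe_step E t)\<^sup>*\<^sup>* (\<lambda>e. f (p ` e)) (\<lambda>e. g (p ` e))"
  using assms by induction (auto dest: kempe_step_edge_image intro: rtranclp.rtrancl_into_rtrancl)

lemma all_kempe_equivalent_edge_image:
  assumes "all_kempe_equivalent ((`) p ` E) t" "E \<noteq> {}"
  shows "all_kempe_equivalent E t"
  unfolding all_kempe_equivalent_def kempe_equivalent_def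
proof (intro allI impI, elim conjE)
  fix f g assume fg: "proper_edge_coloring E t f" "proper_edge_coloring E t g"
  let ?q = "inv_into E ((`) p)"
  have q: "?q (p ` e) = e" if "e \<in> E" for e
    using inv_into_f_f[OF inj_on_edge_image that] .
  have pull: "proper_edge_coloring ((`) p ` E) t (\<lambda>x. f (?q x))"
    using proper_edge_coloring_pullback fg by blast
  have "(kempe_step ((`) p ` E) t)\<^sup>*\<^sup>* (\<lambda>x. f (?q x)) (\<lambda>x. g (?q x))"
    using assms(1) pull proper_edge_coloring_pullback[OF fg(2)]
    unfolding all_kempe_equivalent_def kempe_equivalent_def by blast
  then have "(kempe_step E t)\<^sup>*\<^sup>* (\<lambda>e. f (?q (p ` e))) (\<lambda>e. g (?q (p ` e)))"
    by (rule kempe_steps_edge_image)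
  moreover have "proper_edge_coloring E t (\<lambda>e. f (?q (p ` e)))"
    using pull by (simp add: proper_edge_coloring_edge_image)
  ultimately show "(kempe_step E t)\<^sup>*\<^sup>* f g"
    using assms(2) by (rule kempe_steps_cong_edges) (simp_all add: q)
qed

end

subsection \<open>Removing matchings\<close>

lemma degree_outside: "v \<notin> \<Union>E \<Longrightarrow> degree E v = 0"
  unfolding degree_def by (metis (no_types, lifting) UnionI card.empty empty_Collect_eq)

lemma finite_vertices: "graph E \<Longrightarrow> finite (\<Union>E)"
  unfolding graph_def by (metis card.infinite finite_Union zero_neq_numeral)

lemma degree_le_max_degree:
  assumes "graph E" shows "degree E v \<le> max_degree E"
proof (cases "v \<in> \<Union>E")
  case True
  then show ?thesis using finite_vertices[OF assms] by (auto simp: max_degree_def intro!: Max_ge)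
qed (simp add: degree_outside)

lemma max_degree_attained:
  assumes "graph E" "max_degree E > 0" shows "\<exists>v. degree E v = max_degree E"
proof -
  have "max_degree E \<in> insert 0 (degree E ` \<Union>E)"
    unfolding max_degree_def using finite_vertices[OF assms(1)] by (intro Max_in) auto
  then show ?thesis using assms(2) by auto
qed

lemma max_degree_eqI:
  assumes "graph E" "\<And>v. degree E v \<le> d" "degree E v = d"
  shows "max_degree E = d"
  using degree_le_max_degree[OF assms(1), of v] max_degree_attained[OF assms(1)] assms(2,3)
  by (metis bot_nat_0.not_eq_extremum le_antisym le_zero_eq)

lemma degree_le_colors:
  assumes "proper_edge_coloring E t f" shows "degree E v \<le> t"
  using degree_le_card_colors[OF assms order_refl, of "{1..t}" v]
    proper_edge_coloring_range[OF assms] by simp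

lemma chromatic_index_eqI:
  assumes "proper_edge_coloring E t f" "\<And>g s. proper_edge_coloring E s g \<Longrightarrow> t \<le> s"
  shows "chromatic_index E = t"
  unfolding chromatic_index_def using assms by (intro Least_equality) auto

text \<open>An edge disjoint from all edges of an inclusion-maximal matching could be added to
  it.\<close>

lemma exists_maximal_matching:
  assumes "finite E"
  shows "\<exists>M\<subseteq>E. matching M \<and> (\<forall>e\<in>E. e \<noteq> {} \<longrightarrow> e \<inter> \<Union>M \<noteq> {})"
proof -
  define A where "A = {M. M \<subseteq> E \<and> matching M}"
  have "finite A" "A \<noteq> {}" using assms by (auto simp: matching_def A_def)
  from finite_has_maximal[OF this]
  obtain M where M: "M \<in> A" "\<And>N. N \<in> A \<Longrightarrow> M \<subseteq> N \<Longrightarrow> M = N" by blast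
  have "e \<inter> \<Union>M \<noteq> {}" if "e \<in> E" "e \<noteq> {}" for e
  proof
    assume *: "e \<inter> \<Union>M = {}"
    then have "insert e M \<in> A" using M(1) that by (auto simp: matching_def A_def)
    then have "e \<in> M" using M(2)[of "insert e M"] by blast
    then show False using * that by blast
  qed
  then show ?thesis using M(1) by (auto simp: A_def)
qed

text \<open>Move \<open>M\<close> to the new colour \<open>Suc t\<close> in both colourings. The
  given steps on \<open>E - M\<close> then run beside it, and the move is undone at the
  \<open>g\<close> end by symmetry.\<close>

lemma kempe_steps_via_matching:
  assumes "proper_edge_coloring E t f" "proper_edge_coloring E t g"
    and M: "M \<subseteq> E" "matching M" and "finite E" "E \<noteq> {}"
    and steps: "(kempe_step (E - M) t)\<^sup>*\<^sup>* f g"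
  shows "(kempe_step E (Suc t))\<^sup>*\<^sup>* f g"
proof -
  define ext where "ext h = (\<lambda>e. if e \<in> M then Suc t else h e)" for h :: "'a set \<Rightarrow> nat"
  have rec: "(kempe_step E (Suc t))\<^sup>*\<^sup>* h (ext h)" if "proper_edge_coloring E t h" for h
    unfolding ext_def
    using kempe_steps_recolor_matching[OF that M(1) _ M(2)] M(1) assms(5) finite_subset by blast
  have proper: "proper_edge_coloring E (Suc t) (ext f)"
    using kempe_steps_proper[OF rec] proper_edge_coloring_mono[of E t _ E "Suc t"] assms(1) by simp
  have "(kempe_step E (Suc t))\<^sup>*\<^sup>* (\<lambda>e. if e \<in> E - M then f e else Suc t)
      (\<lambda>e. if e \<in> E - M then g e else Suc t)"
    by (rule kempe_steps_extend[OF steps]) auto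
  then have "(kempe_step E (Suc t))\<^sup>*\<^sup>* (ext f) (ext g)"
  proof (rule kempe_steps_cong_edges)
    show "proper_edge_coloring E (Suc t) (\<lambda>e. if e \<in> E - M then f e else Suc t)"
      using proper by (rule proper_edge_coloring_cong) (simp add: ext_def)
  qed (use assms(6) in \<open>auto simp: ext_def\<close>)
  then show ?thesis
    using rec[OF assms(1)] kempe_steps_sym[OF rec[OF assms(2)]] by (meson rtranclp_trans)
qed

lemma degree_remove_matching:
  assumes "finite E" "M \<subseteq> E" "matching M" "v \<in> \<Union>M"
  shows "degree (E - M) v = degree E v - 1"
proof -
  obtain e where e: "e \<in> M" "v \<in> e" using assms by blast
  then have "{e' \<in> E - M. v \<in> e'} = {e' \<in> E. v \<in> e'} - {e}"
    using assms(3) by (auto simp: matching_def)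
  moreover have "e \<in> {e' \<in> E. v \<in> e'}" using e assms(2) by blast
  ultimately show ?thesis unfolding degree_def by (metis card_Diff_singleton)
qed

lemma degree_remove_uncovered:
  assumes "v \<notin> \<Union>M" shows "degree (E - M) v = degree E v"
proof -
  have "{e \<in> E - M. v \<in> e} = {e \<in> E. v \<in> e}" using assms by blast
  then show ?thesis by (simp add: degree_def)
qed

theorem theorem1p2:
  fixes k :: nat and G :: "'a set set"
  assumes "k \<ge> 4"
    and hyp: "\<forall>H :: nat set set. graph H \<and> max_degree H = k - 1 \<longrightarrow>
                all_kempe_equivalent H (chromatic_index H + 1)"
    and "graph G" and "class2 G" and "max_degree G = k"
  shows "all_kempe_equivalent G (k + 2)"
proof -
  have hyp': "all_kempe_equivalent H (Suc (chromatic_index H))"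
    if H: "graph H" "max_degree H = k - 1" for H :: "'a set set"
  proof -
    obtain p :: "'a \<Rightarrow> nat" where p: "inj_on p (\<Union>H)"
      using finite_imp_inj_to_nat_seg[OF finite_vertices[OF H(1)]] by blast
    have "all_kempe_equivalent ((`) p ` H) (Suc (chromatic_index H))"
      using hyp graph_edge_image[OF p H(1)] max_degree_edge_image[OF p]
        chromatic_index_edge_image[OF p] H(2) by (metis Suc_eq_plus1)
    moreover have "H \<noteq> {}" using H(2) assms(1) by (auto simp: max_degree_def)
    ultimately show ?thesis using all_kempe_equivalent_edge_image[OF p] by blast
  qed
  have finG: "finite G" and card2: "\<And>e. e \<in> G \<Longrightarrow> card e = 2"
    using assms(3) by (auto simp: graph_def)
  have degG: "degree G v \<le> k" for v using degree_le_max_degree[OF assms(3)] assms(5) by blast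
  obtain v0 where v0: "degree G v0 = k" using max_degree_attained[OF assms(3)] assms(1,5) by auto
  obtain M where M: "M \<subseteq> G" "matching M" and Mmax: "\<And>e. e \<in> G \<Longrightarrow> e \<inter> \<Union>M \<noteq> {}"
    using exists_maximal_matching[OF finG] card2 by (metis card.empty zero_neq_numeral)
  define E where "E = G - M"
  have E: "E \<subseteq> G" "graph E" "finite E"
    using assms(3) by (auto simp: E_def graph_def)
  have degE: "degree E v \<le> degree G v" for v using degree_mono[OF finG E(1)] .
  have covered: "degree E v \<le> k - 1" if "v \<in> \<Union>M" for v
    using degree_remove_matching[OF finG M that] degG[of v] by (simp add: E_def)
  have steps: "(kempe_step E (Suc k))\<^sup>*\<^sup>* f g"
    if f: "proper_edge_coloring E (Suc k) f" and g: "proper_edge_coloring E (Suc k) g" for f g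
  proof (cases "\<forall>v. degree G v = k \<longrightarrow> v \<in> \<Union>M")
    case True
    have degE': "degree E v \<le> k - 1" for v
    proof (cases "v \<in> \<Union>M")
      case False
      with True have "degree G v \<noteq> k" by blast
      then show ?thesis using degG[of v] degE[of v] by linarith
    qed (rule covered)
    have "degree E v0 = k - 1"
      using degree_remove_matching[OF finG M] True v0 by (simp add: E_def)
    with degE' have "max_degree E = k - 1" by (rule max_degree_eqI[OF E(2)])
    \<comment> \<open>The reduction with \<open>t = k\<close>: all degrees are below
      \<open>k\<close>, so its independence condition holds trivially.\<close>
    moreover obtain h where h: "proper_edge_coloring E k h"
      using kempe_reduce_colors[OF E(2) _ _ f] degE' assms(1)
      by (metis Suc_pred' le_SucI le_imp_less_Suc less_le_trans zero_less_numeral)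
    have "chromatic_index E = k"
    \<comment> \<open>With fewer than \<open>k\<close> colours on \<open>E\<close>, colour
      \<open>k\<close> would be free for \<open>M\<close>, and \<open>G\<close> would have a
      \<open>k\<close>-colouring, against Class 2.\<close>
    proof (rule chromatic_index_eqI[OF h], rule ccontr)
      fix s h assume s: "proper_edge_coloring E s h" "\<not> k \<le> s"
      have "proper_edge_coloring G k (\<lambda>e. if e \<in> M then k else h e)"
        unfolding proper_edge_coloring_def
      proof (intro conjI ballI impI)
        fix e assume "e \<in> G"
        then show "(if e \<in> M then k else h e) \<in> {1..k}"
          using proper_edge_coloring_range[OF s(1), of e] s(2) assms(1) by (auto simp: E_def)
      next
        fix e e' assume e: "e \<in> G" "e' \<in> G" "e \<noteq> e' \<and> e \<inter> e' \<noteq> {}"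
        have "h e \<noteq> k" if "e \<in> E" for e
          using proper_edge_coloring_range[OF s(1) that] s(2) by simp
        note this[of e] this[of e']
        moreover have "h e \<noteq> h e'" if "e \<in> E" "e' \<in> E"
          using s(1) e that unfolding proper_edge_coloring_def by blast
        moreover have "\<not> (e \<in> M \<and> e' \<in> M)" using M(2) e unfolding matching_def by blast
        ultimately show "(if e \<in> M then k else h e) \<noteq> (if e' \<in> M then k else h e')"
          using e(1,2) by (auto simp: E_def)
      qed
      then have "chromatic_index G \<le> k" unfolding chromatic_index_def by (blast intro: Least_le)
      then show False using assms(4,5) by (simp add: class2_def)
    qed
    ultimately have "all_kempe_equivalent E (Suc k)" using hyp'[OF E(2)] by simp
    then show ?thesis using f g by (simp add: all_kempe_equivalent_def kempe_equivalent_def)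
  next
    case False
    then obtain v where v: "degree G v = k" "v \<notin> \<Union>M" by blast
    then have degv: "degree E v = k" using degree_remove_uncovered[of v M G] by (simp add: E_def)
    have Ene: "E \<noteq> {}" using degv assms(1) by (auto simp: degree_def)
    have degEk: "degree E w \<le> k" for w using degE degG le_trans by blast
    \<comment> \<open>Every edge meets the maximal matching, and an end covered by \<open>M\<close>
      has lost an edge.\<close>
    have indep: "degree E u < k \<or> degree E w < k" if "{u, w} \<in> E" for u w
      using Mmax[of "{u, w}"] that E(1) covered[of u] covered[of w] assms(1) by force
    note reduce = kempe_reduce_colors[OF E(2) degEk indep]
    obtain f' where f': "(kempe_step E (Suc k))\<^sup>*\<^sup>* f f'" "proper_edge_coloring E k f'"
      using reduce[OF _ f] by blast
    obtain g' where g': "(kempe_step E (Suc k))\<^sup>*\<^sup>* g g'" "proper_edge_coloring E k g'"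
      using reduce[OF _ g] by blast
    define N where "N = {e\<in>E. f' e = k}"
    define H where "H = E - N"
    have N: "N \<subseteq> E" "matching N"
      using proper_edge_coloringD[OF f'(2)] by (auto simp: N_def matching_def)
    have H: "graph H" "H \<subseteq> E" using E(2) by (auto simp: H_def graph_def)
    have f'H: "proper_edge_coloring H (k - 1) f'"
      using f'(2) by (fastforce simp: proper_edge_coloring_def H_def N_def)
    \<comment> \<open>Only \<open>k - 1\<close> colours remain on \<open>H\<close>, so
      \<open>N\<close> must cover \<open>v\<close>, which has degree \<open>k\<close> in
      \<open>E\<close>. This \<open>v\<close> fixes both the maximum degree and the chromatic index
      of \<open>H\<close>.\<close>
    have degvH: "degree H v = k - 1"
    proof -
      have "v \<in> \<Union>N"
      proof (rule ccontr)
        assume "v \<notin> \<Union>N"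
        then have "degree H v = k" using degv by (simp add: H_def degree_remove_uncovered)
        then show False using degree_le_colors[OF f'H, of v] assms(1) by simp
      qed
      then show ?thesis using degree_remove_matching[OF E(3) N] degv by (simp add: H_def)
    qed
    have "max_degree H = k - 1"
      using max_degree_eqI[OF H(1) degree_le_colors[OF f'H] degvH] .
    moreover have "chromatic_index H = k - 1"
      using chromatic_index_eqI[OF f'H] degree_le_colors[of H _ _ v] degvH by metis
    ultimately have "all_kempe_equivalent H k" using hyp'[OF H(1)] assms(1) by simp
    \<comment> \<open>\<open>N\<close> comes from \<open>f'\<close> alone; \<open>g'\<close> may use
      all \<open>k\<close> colours on \<open>H\<close>, which is one more than the chromatic index
      and hence within reach of the hypothesis.\<close>
    then have "(kempe_step H k)\<^sup>*\<^sup>* f' g'"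
      using proper_edge_coloring_mono[OF _ H(2) order_refl] f'(2) g'(2)
      unfolding all_kempe_equivalent_def kempe_equivalent_def by blast
    then have "(kempe_step E (Suc k))\<^sup>*\<^sup>* f' g'"
      using kempe_steps_via_matching[OF f'(2) g'(2) N E(3) Ene] by (simp add: H_def)
    then show ?thesis using f'(1) kempe_steps_sym[OF g'(1)] by (meson rtranclp_trans)
  qed
  have Gne: "G \<noteq> {}" using v0 assms(1) by (auto simp: degree_def)
  \<comment> \<open>The reduction with \<open>t = k + 1\<close>, which exceeds every degree of
    \<open>G\<close>.\<close>
  have reduce: "\<exists>g. (kempe_step G (k + 2))\<^sup>*\<^sup>* f g \<and> proper_edge_coloring G (Suc k) g"
    if "proper_edge_coloring G (k + 2) f" for f
    using kempe_reduce_colors[OF assms(3), of "Suc k" f] degG that by (simp add: le_SucI less_Suc_eq_le)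
  show ?thesis
    unfolding all_kempe_equivalent_def kempe_equivalent_def
  proof (intro allI impI, elim conjE)
    fix f g assume "proper_edge_coloring G (k + 2) f" "proper_edge_coloring G (k + 2) g"
    then obtain f' g' where f': "(kempe_step G (k + 2))\<^sup>*\<^sup>* f f'" "proper_edge_coloring G (Suc k) f'"
      and g': "(kempe_step G (k + 2))\<^sup>*\<^sup>* g g'" "proper_edge_coloring G (Suc k) g'"
      using reduce by meson
    have "(kempe_step G (k + 2))\<^sup>*\<^sup>* f' g'"
      using kempe_steps_via_matching[OF f'(2) g'(2) M finG Gne] steps
        proper_edge_coloring_mono[OF _ E(1) order_refl] f'(2) g'(2) by (simp add: E_def)
    then show "(kempe_step G (k + 2))\<^sup>*\<^sup>* f g"
      using f'(1) kempe_steps_sym[OF g'(1)] by (meson rtranclp_trans)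
  qed
qed

end
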